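(* If $\Phi\subset N_{\mathbb R}$ is a lattice polygonal domain and $t\in\mathbb N$, then $\Phi[t]=\Phi(t)$.
   Context: $N\cong\mathbb Z^2$ is a rank two lattice, $N_{\mathbb R}=N\otimes\mathbb R$, $M=\operatorname{Hom}(N,\mathbb Z)$. A lattice polygonal domain is a (non-empty) proper closed subset $\Phi\subset N_{\mathbb R}$ that can be represented as the convex hull of a (possibly infinite) collection of points of $N$. Its lattice evolution is the sequence $\Phi=\Phi[0]\supset\Phi[1]\supset\Phi[2]\supset\dots$, where for each integer $t\ge1$, $\Phi[t]$ is the convex hull of the set of lattice points (points of $N$) in the interior of $\Phi[t-1]$ (the convex hull of the empty set being empty). A half-plane with rational slope is $H=\{p\in N_{\mathbb R}:\lambda(p)\ge c\}$ with $c\in\mathbb R$ and $\lambda\in M$ primitive; for $t\in\mathbb R$, $H(t)=\{p:\lambda(p)\ge c+t\}$. For a closed convex $\Phi$, $\mathcal H_\Phi$ is the set of rational-slope half-planes $H$ with $H\supset\Phi$ and $\partial H\cap\partial\Phi\neq\emptyset$, and for $t\ge0$ the tropical propagation is $\Phi(t)=\bigcap_{H\in\mathcal H_\Phi}H(t)$. *)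

theory Defs
  imports "HOL-Analysis.Analysis"
begin

text \<open>
  The ambient Euclidean type plays the role of \<open>N \<otimes> \<real>\<close>: the spanning condition forces it to be
  two-dimensional. Only its vector space structure and topology are used below, never its inner
  product.
\<close>

definition rank_two_lattice :: "'a::euclidean_space set \<Rightarrow> bool" where
  "rank_two_lattice N \<longleftrightarrow>
     (\<exists>e1 e2. e1 \<noteq> e2 \<and> independent {e1, e2} \<and> span {e1, e2} = UNIV \<and>
        N = {of_int m *\<^sub>R e1 + of_int n *\<^sub>R e2 | m n :: int. True})"

text \<open>
  A homomorphism \<open>N \<rightarrow> \<int>\<close> is represented by its unique linear extension to \<open>N \<otimes> \<real>\<close>.
\<close>

definition dual_lattice :: "'a::euclidean_space set \<Rightarrow> ('a \<Rightarrow> real) set" where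
  "dual_lattice N = {l. linear l \<and> l ` N \<subseteq> \<int>}"

definition primitive_functional :: "'a::euclidean_space set \<Rightarrow> ('a \<Rightarrow> real) \<Rightarrow> bool" where
  "primitive_functional N l \<longleftrightarrow>
     l \<in> dual_lattice N \<and> l \<noteq> (\<lambda>p. 0) \<and>
     (\<forall>k::int. \<forall>m \<in> dual_lattice N. l = (\<lambda>p. of_int k * m p) \<longrightarrow> \<bar>k\<bar> = 1)"

definition lattice_polygonal_domain :: "'a::euclidean_space set \<Rightarrow> 'a set \<Rightarrow> bool" where
  "lattice_polygonal_domain N \<Phi> \<longleftrightarrow>
     \<Phi> \<noteq> {} \<and> \<Phi> \<noteq> UNIV \<and> closed \<Phi> \<and> (\<exists>S \<subseteq> N. \<Phi> = convex hull S)"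

primrec lattice_evolution :: "'a::euclidean_space set \<Rightarrow> 'a set \<Rightarrow> nat \<Rightarrow> 'a set" where
  "lattice_evolution N \<Phi> 0 = \<Phi>"
| "lattice_evolution N \<Phi> (Suc t) = convex hull (N \<inter> interior (lattice_evolution N \<Phi> t))"

definition half_plane :: "('a::euclidean_space \<Rightarrow> real) \<Rightarrow> real \<Rightarrow> 'a set" where
  "half_plane l c = {p. l p \<ge> c}"

text \<open>
  A half-plane with rational slope determines its primitive functional and its constant \<open>c\<close>, so
  it is represented by the pair \<open>(l, c)\<close>; its translate \<open>H(t)\<close> is \<open>half_plane l (c + t)\<close>.
\<close>

definition supporting_half_planes ::
    "'a::euclidean_space set \<Rightarrow> 'a set \<Rightarrow> (('a \<Rightarrow> real) \<times> real) set" where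
  "supporting_half_planes N \<Phi> =
     {(l, c). primitive_functional N l \<and> \<Phi> \<subseteq> half_plane l c \<and>
        frontier (half_plane l c) \<inter> frontier \<Phi> \<noteq> {}}"

definition tropical_propagation :: "'a::euclidean_space set \<Rightarrow> 'a set \<Rightarrow> real \<Rightarrow> 'a set" where
  "tropical_propagation N \<Phi> t = (\<Inter>(l, c) \<in> supporting_half_planes N \<Phi>. half_plane l (c + t))"

end

(*
A functional in M is integral on lattice points, so a lattice point in the interior of Phi(t)
satisfies each inequality defining Phi(t) with slack 1; together with local finiteness inside
Phi this shows that the lattice points in the interior of Phi(t) are those of Phi(t + 1).
Hence it suffices that Phi(0) = Phi and that, for t >= 1, Phi(t) is the convex hull of its
lattice points.  For the former every boundary point of Phi needs a supporting line of rational
slope.  For the latter, two independent functionals tight at a point of Phi(t) force that point to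
be a lattice point: completing the first to a basis within the triangle they span gives, by
concavity of the support function, a tight basis.  A point with a single tight functional is then
reached by moving along the corresponding edge in both directions, a point with integral first
coordinate by moving parallel to e2, and an arbitrary point by moving parallel to e1.
*)
theory Submission imports Defs begin

section \<open>Lattice coordinates and primitive functionals\<close>

locale lattice_coordinates =
  fixes e1 e2 :: "'a::euclidean_space" and x y :: "'a \<Rightarrow> real" and N :: "'a set"
  assumes linear_x: "linear x" and linear_y: "linear y"
    and decomp: "p = x p *\<^sub>R e1 + y p *\<^sub>R e2"
    and coord_e [simp]: "x e1 = 1" "x e2 = 0" "y e1 = 0" "y e2 = 1"
    and mem_N: "p \<in> N \<longleftrightarrow> x p \<in> \<int> \<and> y p \<in> \<int>"
begin

lemmas coord_simps [simp] =
  linear_add [OF linear_x] linear_diff [OF linear_x] linear_cmul [OF linear_x]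
  linear_neg [OF linear_x] linear_0 [OF linear_x]
  linear_add [OF linear_y] linear_diff [OF linear_y] linear_cmul [OF linear_y]
  linear_neg [OF linear_y] linear_0 [OF linear_y]

text \<open>Integral coordinates on the dual lattice; in them, primitive means coprime.\<close>

definition lf :: "int \<Rightarrow> int \<Rightarrow> 'a \<Rightarrow> real" where
  "lf a b p = of_int a * x p + of_int b * y p"

lemma linear_lf: "linear (lf a b)"
  unfolding lf_def by (rule linearI) (simp_all add: algebra_simps)

lemmas lf_simps [simp] =
  linear_add [OF linear_lf] linear_diff [OF linear_lf] linear_cmul [OF linear_lf]
  linear_neg [OF linear_lf] linear_0 [OF linear_lf]

lemma lf_Ints: "p \<in> N \<Longrightarrow> lf a b p \<in> \<int>"
  by (simp add: lf_def mem_N)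

lemma lf_of_int:
  assumes "p \<in> N"
  obtains k where "lf a b p = of_int k"
  using lf_Ints [OF assms] by (rule Ints_cases)

text \<open>Supplies the normal vector through which facts about half-spaces are phrased. It is
  non-zero because the functional takes the value a^2 + b^2 at the vector with coordinates (a,
  b).\<close>

lemma lf_inner:
  assumes "coprime a b"
  obtains g where "g \<noteq> 0" "lf a b = (\<lambda>p. g \<bullet> p)"
proof -
  define g where "g = adjoint (lf a b) 1"
  have g: "lf a b p = g \<bullet> p" for p
    using adjoint_works [OF linear_lf, of p a b 1] by (simp add: g_def inner_commute)
  have "lf a b (of_int a *\<^sub>R e1 + of_int b *\<^sub>R e2) = of_int (a * a + b * b)"
    by (simp add: lf_def)
  moreover have "a * a + b * b \<noteq> 0"
    using assms by (auto simp: sum_squares_eq_zero_iff)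
  ultimately have "g \<noteq> 0"
    using g by (metis inner_zero_left of_int_eq_0_iff)
  with g that show thesis
    by blast
qed

lemma continuous_lf: "continuous_on A (lf a b)"
  by (simp add: linear_continuous_on linear_conv_bounded_linear[symmetric] linear_lf)

lemma open_lf_greater: "open {p. r < lf a b p}"
  by (intro open_Collect_less continuous_intros continuous_lf)

text \<open>Dividing by the gcd of the values at \<open>e1\<close> and \<open>e2\<close> leaves an
  integral functional, so primitivity forces the gcd to be 1; conversely, an integer factor of the
  functional divides both values.\<close>

lemma primitive_functional_iff:
  "primitive_functional N l \<longleftrightarrow> (\<exists>a b. coprime a b \<and> l = lf a b)"
proof
  assume l: "primitive_functional N l"
  then have lin: "linear l" and int: "l ` N \<subseteq> \<int>"
    by (auto simp: primitive_functional_def dual_lattice_def)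
  have "e1 \<in> N" "e2 \<in> N"
    by (simp_all add: mem_N)
  with int obtain a b where ab: "l e1 = of_int a" "l e2 = of_int b"
    by (meson Ints_cases imageI subsetD)
  have l_eq: "l = lf a b"
  proof
    fix p
    have "l p = l (x p *\<^sub>R e1 + y p *\<^sub>R e2)"
      using decomp by metis
    also have "\<dots> = lf a b p"
      by (simp add: linear_add [OF lin] linear_cmul [OF lin] ab lf_def)
    finally show "l p = lf a b p" .
  qed
  have "gcd a b \<noteq> 0"
    using l l_eq by (auto simp: primitive_functional_def lf_def)
  then obtain a' b' where ab': "a = a' * gcd a b" "b = b' * gcd a b" "coprime a' b'"
    using gcd_coprime_exists by blast
  have "of_int a = of_int (gcd a b) * (of_int a' :: real)"
    "of_int b = of_int (gcd a b) * (of_int b' :: real)"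
    by (metis ab'(1) mult.commute of_int_mult) (metis ab'(2) mult.commute of_int_mult)
  then have "l = (\<lambda>p. of_int (gcd a b) * lf a' b' p)"
    unfolding l_eq lf_def by (simp add: algebra_simps)
  moreover have "lf a' b' \<in> dual_lattice N"
    using lf_Ints linear_lf by (auto simp: dual_lattice_def)
  ultimately have "\<bar>gcd a b\<bar> = 1"
    using l unfolding primitive_functional_def by blast
  then have "coprime a b"
    by (simp add: coprime_iff_gcd_eq_1)
  with l_eq show "\<exists>a b. coprime a b \<and> l = lf a b"
    by blast
next
  assume "\<exists>a b. coprime a b \<and> l = lf a b"
  then obtain a b where ab: "coprime a b" "l = lf a b"
    by blast
  have vals: "lf a b e1 = of_int a" "lf a b e2 = of_int b"
    by (simp_all add: lf_def)
  have "lf a b \<noteq> (\<lambda>p. 0)"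
  proof
    assume "lf a b = (\<lambda>p. 0)"
    then have "a = 0" "b = 0"
      using vals by simp_all
    with ab show False by simp
  qed
  moreover have "\<bar>k\<bar> = 1"
    if m: "m \<in> dual_lattice N" "lf a b = (\<lambda>p. of_int k * m p)" for k m
  proof -
    have "m e1 \<in> \<int>" "m e2 \<in> \<int>"
      using m(1) by (auto simp: dual_lattice_def mem_N image_subset_iff)
    then obtain i j where "m e1 = of_int i" "m e2 = of_int j"
      by (meson Ints_cases)
    with m(2) vals have "of_int a = (of_int (k * i) :: real)" "of_int b = (of_int (k * j) :: real)"
      by simp_all
    then have "a = k * i" "b = k * j"
      by linarith+
    then have "k dvd a" "k dvd b"
      by simp_all
    with ab(1) have "k dvd 1"
      by (meson coprime_common_divisor)
    then show ?thesis
      by simp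
  qed
  ultimately show "primitive_functional N l"
    using ab lf_Ints linear_lf by (auto simp: primitive_functional_def dual_lattice_def)
qed

text \<open>A norm adapted to the lattice basis: distinct lattice points are at distance at least 1,
  which the Euclidean norm does not guarantee.\<close>

definition norm1 :: "'a \<Rightarrow> real" where
  "norm1 v = \<bar>x v\<bar> + \<bar>y v\<bar>"

lemma norm1_scaleR: "norm1 (r *\<^sub>R v) = \<bar>r\<bar> * norm1 v"
  by (simp add: norm1_def abs_mult distrib_left)

lemma continuous_norm1: "continuous_on A norm1"
  unfolding norm1_def
  by (intro continuous_intros linear_continuous_on)
    (simp_all add: linear_conv_bounded_linear[symmetric] linear_x linear_y)

lemma norm_le_norm1: "norm v \<le> (norm e1 + norm e2) * norm1 v"
proof -
  have "norm v \<le> \<bar>x v\<bar> * norm e1 + \<bar>y v\<bar> * norm e2"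
    by (subst decomp [of v]) (metis norm_scaleR norm_triangle_ineq)
  also have "\<dots> \<le> (norm e1 + norm e2) * norm1 v"
    by (simp add: norm1_def algebra_simps)
  finally show ?thesis .
qed

lemma norm1_ge_1:
  assumes "p \<in> N" "q \<in> N" "p \<noteq> q"
  shows "norm1 (p - q) \<ge> 1"
proof -
  have "x (p - q) \<in> \<int>" "y (p - q) \<in> \<int>"
    using assms by (auto simp: mem_N)
  moreover have "x (p - q) \<noteq> 0 \<or> y (p - q) \<noteq> 0"
    using assms decomp [of p] decomp [of q] by auto
  ultimately have "1 \<le> \<bar>x (p - q)\<bar> \<or> 1 \<le> \<bar>y (p - q)\<bar>"
    using Ints_nonzero_abs_ge1 by blast
  then show ?thesis
    unfolding norm1_def by linarith
qed

lemma lattice_point_on_ray: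
  assumes "coprime a b" and "lf a b p \<in> \<int>"
  obtains s where "0 \<le> s" "p + s *\<^sub>R (of_int a *\<^sub>R e2 - of_int b *\<^sub>R e1) \<in> N"
proof -
  obtain f e where "f * a + e * b = gcd a b"
    using bezout_int by blast
  then have fe: "f * a + e * b = 1"
    using assms by simp
  then have fe': "of_int f * of_int a + of_int e * of_int b = (1::real)"
    by (metis of_int_1 of_int_add of_int_mult)
  obtain k where k: "lf a b p = of_int k"
    using assms(2) by (auto elim: Ints_cases)
  \<comment> \<open>With the Bezout solution (f, e), the point \<open>p\<close> has coordinates k
    (f, e) + r (-b, a). Rounding \<open>r\<close> up gives the next lattice point on the level
    line.\<close>
  define r where "r = of_int f * y p - of_int e * x p"
  define s where "s = of_int \<lceil>r\<rceil> - r"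
  have kk: "of_int k = of_int a * x p + of_int b * y p"
    using k by (simp add: lf_def)
  have "x p = of_int k * of_int f - r * of_int b"
    unfolding kk r_def using fe' by algebra
  then have X: "x (p + s *\<^sub>R (of_int a *\<^sub>R e2 - of_int b *\<^sub>R e1)) = of_int (k * f - \<lceil>r\<rceil> * b)"
    by (simp add: s_def algebra_simps)
  have "y p = of_int k * of_int e + r * of_int a"
    unfolding kk r_def using fe' by algebra
  then have Y: "y (p + s *\<^sub>R (of_int a *\<^sub>R e2 - of_int b *\<^sub>R e1)) = of_int (k * e + \<lceil>r\<rceil> * a)"
    by (simp add: s_def algebra_simps)
  have "0 \<le> s"
    by (simp add: s_def)
  moreover have "p + s *\<^sub>R (of_int a *\<^sub>R e2 - of_int b *\<^sub>R e1) \<in> N"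
    unfolding mem_N X Y by simp
  ultimately show thesis
    by (rule that)
qed

end

text \<open>
  The triangle with vertices \<open>0\<close>, \<open>(a, b)\<close>, \<open>(c, d)\<close> contains a lattice point that completes
  \<open>(a, b)\<close> to a basis of the lattice.
\<close>
lemma basis_completion_in_triangle:
  fixes a b c d n :: int
  assumes "coprime a b" and n: "n = a * d - b * c" and "n > 0"
  obtains e f i where "n * e = i * a + c" "n * f = i * b + d" "0 \<le> i" "i < n" "a * f - b * e = 1"
proof -
  obtain u v where uv: "u * a + v * b = gcd a b"
    using bezout_int by blast
  then have uv: "u * a + v * b = 1"
    using assms by simp
  define k where "k = u * c + v * d"
  \<comment> \<open>Every pair (m a - v, m b + u) completes (a, b) to a basis. Taking
    \<open>m\<close> as the ceiling of k / n puts \<open>i\<close> between 0 and n - 1, so the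
    weights i / n and 1 / n of (a, b) and (c, d) sum to at most 1.\<close>
  define m where "m = - ((- k) div n)"
  define e where "e = m * a - v"
  define f where "f = m * b + u"
  define i where "i = (- k) mod n"
  have i: "i = n * m - k"
    unfolding i_def m_def minus_mult_div_eq_mod [symmetric] by simp
  have "n * e = i * a + c" "n * f = i * b + d"
    unfolding i e_def f_def k_def n using uv by algebra+
  moreover have "a * f - b * e = 1"
    unfolding e_def f_def using uv by algebra
  ultimately show thesis
    using that \<open>n > 0\<close> by (simp add: i_def)
qed

section \<open>Integral inequalities valid on the hull\<close>

locale lattice_hull = lattice_coordinates +
  fixes S \<Phi> :: "'a set"
  assumes S_subset: "S \<subseteq> N" and \<Phi>_hull: "\<Phi> = convex hull S" and closed_\<Phi>: "closed \<Phi>"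
    and \<Phi>_nonempty: "\<Phi> \<noteq> {}"
begin

lemma convex_\<Phi>: "convex \<Phi>"
  by (simp add: \<Phi>_hull)

lemma S_in_\<Phi>: "s \<in> S \<Longrightarrow> s \<in> \<Phi>"
  by (simp add: \<Phi>_hull hull_inc)

definition valid :: "int \<Rightarrow> int \<Rightarrow> int \<Rightarrow> bool" where
  "valid a b c \<longleftrightarrow> (\<forall>q\<in>\<Phi>. of_int c \<le> lf a b q)"

text \<open>
  This is \<open>\<Phi>(t)\<close> with the constants restricted to integers and not required to be attained on
  \<open>\<Phi>\<close>; integrality of functionals on \<open>S\<close> makes the two descriptions agree.
\<close>
definition shrink :: "nat \<Rightarrow> 'a set" where
  "shrink t = {p. \<forall>a b c. coprime a b \<longrightarrow> valid a b c \<longrightarrow> of_int c + of_nat t \<le> lf a b p}"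

lemma shrinkD: "p \<in> shrink t \<Longrightarrow> coprime a b \<Longrightarrow> valid a b c \<Longrightarrow> of_int c + of_nat t \<le> lf a b p"
  by (auto simp: shrink_def)

lemma convex_lf_ge: "convex {p. r \<le> lf a b p}"
  using convex_linear_vimage [OF linear_lf convex_real_interval(1), of a b r]
  by (simp add: vimage_def)

lemma \<Phi>_lower_bound:
  assumes "\<And>s. s \<in> S \<Longrightarrow> r \<le> lf a b s" "q \<in> \<Phi>"
  shows "r \<le> lf a b q"
proof -
  have "convex hull S \<subseteq> {p. r \<le> lf a b p}"
    using assms by (intro hull_minimal convex_lf_ge) auto
  then show ?thesis
    using assms \<Phi>_hull by auto
qed

text \<open>The functional is integral on the generators \<open>S\<close>, so a lower bound can be
  rounded up there, and bounds on \<open>S\<close> pass to the hull.\<close>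

lemma valid_ceiling:
  assumes "\<And>q. q \<in> \<Phi> \<Longrightarrow> r \<le> lf a b q"
  shows "valid a b \<lceil>r\<rceil>"
  unfolding valid_def
proof (rule ballI, rule \<Phi>_lower_bound)
  fix s assume "s \<in> S"
  then obtain k where "lf a b s = of_int k"
    using S_subset lf_of_int by blast
  then show "of_int \<lceil>r\<rceil> \<le> lf a b s"
    using assms [OF S_in_\<Phi> [OF \<open>s \<in> S\<close>]] by (simp add: ceiling_le_iff)
qed

text \<open>A point of \<Phi> bounds the valid constants from above, so there is a largest one,
  \<open>d\<close>. As \<open>d + 1\<close> fails at some generator, where the value is an integer,
  that generator attains \<open>d\<close>.\<close>

lemma valid_attained:
  assumes "valid a b c"
  obtains d q where "c \<le> d" "valid a b d" "q \<in> \<Phi>" "lf a b q = of_int d"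
proof -
  have bdd: "d \<le> \<lfloor>lf a b q\<rfloor>" if "valid a b d" "q \<in> \<Phi>" for d q
    using that by (simp add: valid_def le_floor_iff)
  obtain q0 where q0: "q0 \<in> \<Phi>"
    using \<Phi>_nonempty by blast
  define D where "D = {d. valid a b d \<and> c \<le> d}"
  have "finite D"
    by (rule finite_subset [of _ "{c..\<lfloor>lf a b q0\<rfloor>}"]) (use bdd [OF _ q0] in \<open>auto simp: D_def\<close>)
  moreover have "c \<in> D"
    using assms by (simp add: D_def)
  ultimately have d: "Max D \<in> D" "\<And>d. d \<in> D \<Longrightarrow> d \<le> Max D"
    by (auto intro: Max_in)
  define d where "d = Max D"
  have "\<not> valid a b (d + 1)"
    using d by (fastforce simp: D_def d_def)
  then obtain s where s: "s \<in> S" "lf a b s < of_int (d + 1)"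
    unfolding valid_def using \<Phi>_lower_bound by (metis not_le)
  obtain k where k: "lf a b s = of_int k"
    using S_subset lf_of_int s(1) by blast
  have "d \<le> k"
    using d(1) S_in_\<Phi> [OF s(1)] k by (force simp: D_def d_def valid_def)
  then have "lf a b s = of_int d"
    using s(2) k by simp
  then show thesis
    using that d(1) S_in_\<Phi> [OF s(1)] by (auto simp: D_def d_def)
qed

text \<open>An integral constant can be raised until it is attained, and then its half-plane touches
  the boundary of \<Phi>; conversely, a real constant can be rounded up, which only strengthens the
  inequality.\<close>

lemma tropical_propagation_eq: "tropical_propagation N \<Phi> (of_nat t) = shrink t"
proof (intro set_eqI iffI)
  fix p assume p: "p \<in> tropical_propagation N \<Phi> (of_nat t)"
  show "p \<in> shrink t"
    unfolding shrink_def
  proof (intro CollectI allI impI)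
    fix a b c assume ab: "coprime a b" and "valid a b c"
    then obtain d q where d: "c \<le> d" "valid a b d" "q \<in> \<Phi>" "lf a b q = of_int d"
      using valid_attained by blast
    obtain g where g: "g \<noteq> 0" "lf a b = (\<lambda>p. g \<bullet> p)"
      using lf_inner [OF ab] by blast
    have sub: "\<Phi> \<subseteq> half_plane (lf a b) (of_int d)"
      using d(2) by (auto simp: valid_def half_plane_def)
    have "interior (half_plane (lf a b) (of_int d)) = {p. of_int d < lf a b p}"
      using g by (simp add: half_plane_def)
    with interior_mono [OF sub] d(4) have "q \<notin> interior \<Phi>"
      by auto
    then have "q \<in> frontier \<Phi>"
      using d(3) closed_\<Phi> by (simp add: frontier_def)
    moreover have "q \<in> frontier (half_plane (lf a b) (of_int d))"
      using g d(4) frontier_halfspace_ge [of g "of_int d"] by (simp add: half_plane_def)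
    ultimately have "(lf a b, of_int d) \<in> supporting_half_planes N \<Phi>"
      using sub ab by (auto simp: supporting_half_planes_def primitive_functional_iff)
    with p have "lf a b p \<ge> of_int d + of_nat t"
      by (auto simp: tropical_propagation_def half_plane_def)
    with d(1) show "of_int c + of_nat t \<le> lf a b p"
      by simp
  qed
next
  fix p assume p: "p \<in> shrink t"
  show "p \<in> tropical_propagation N \<Phi> (of_nat t)"
    unfolding tropical_propagation_def
  proof clarify
    fix l c assume "(l, c) \<in> supporting_half_planes N \<Phi>"
    then obtain a b where ab: "coprime a b" "l = lf a b" and sub: "\<Phi> \<subseteq> half_plane l c"
      by (auto simp: supporting_half_planes_def primitive_functional_iff)
    have "valid a b \<lceil>c\<rceil>"
      using sub ab(2) by (intro valid_ceiling) (auto simp: half_plane_def)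
    from shrinkD [OF p ab(1) this] show "p \<in> half_plane l (c + of_nat t)"
      using le_of_int_ceiling [of c] unfolding half_plane_def ab(2) mem_Collect_eq by linarith
  qed
qed

section \<open>Supporting lines of rational slope\<close>

lemma hull_Int_hyperplane:
  assumes "p \<in> \<Phi>" "\<And>q. q \<in> \<Phi> \<Longrightarrow> g \<bullet> p \<le> g \<bullet> q"
  shows "p \<in> convex hull (S \<inter> {q. g \<bullet> q = g \<bullet> p})"
proof -
  define F where "F = convex hull (S \<inter> {q. g \<bullet> q = g \<bullet> p})"
  have F: "g \<bullet> q = g \<bullet> p" if "q \<in> F" for q
    using hull_minimal [of "S \<inter> {q. g \<bullet> q = g \<bullet> p}" "{q. g \<bullet> q = g \<bullet> p}" convex] that
    by (auto simp: F_def convex_hyperplane)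
  \<comment> \<open>A proper combination of two points of this set has a larger value than
    \<open>p\<close> unless both points lie in the face \<open>F\<close>. Being convex and
    containing \<open>S\<close>, the set contains \<Phi>.\<close>
  have "convex ({q. g \<bullet> q > g \<bullet> p} \<union> F)"
  proof (rule convexI)
    fix q r and u v :: real
    assume q: "q \<in> {q. g \<bullet> q > g \<bullet> p} \<union> F" and r: "r \<in> {q. g \<bullet> q > g \<bullet> p} \<union> F"
      and uv: "0 \<le> u" "0 \<le> v" "u + v = 1"
    show "u *\<^sub>R q + v *\<^sub>R r \<in> {q. g \<bullet> q > g \<bullet> p} \<union> F"
    proof -
      have "convex F"
        by (simp add: F_def)
      consider "u = 0" "v = 1" | "v = 0" "u = 1" | "q \<in> F" "r \<in> F"
        | "u \<noteq> 0" "v \<noteq> 0" "\<not> (q \<in> F \<and> r \<in> F)"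
        using uv(3) by fastforce
      then show ?thesis
      proof cases
        case 3
        then show ?thesis
          using convexD [OF \<open>convex F\<close>] uv by blast
      next
        case 4
        then have pos: "u > 0" "v > 0"
          using uv by auto
        have ge: "g \<bullet> q \<ge> g \<bullet> p" "g \<bullet> r \<ge> g \<bullet> p" "g \<bullet> q > g \<bullet> p \<or> g \<bullet> r > g \<bullet> p"
          using q r F 4(3) by force+
        have "g \<bullet> p = u * (g \<bullet> p) + v * (g \<bullet> p)"
          using uv(3) by (metis distrib_right mult_1)
        also have "\<dots> < u * (g \<bullet> q) + v * (g \<bullet> r)"
          using ge pos
          by (metis add_le_less_mono add_less_le_mono mult_left_mono mult_strict_left_mono less_imp_le)
        finally show ?thesis
          by (simp add: inner_add_right)
      qed (use q r in auto)
    qed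
  qed
  moreover have "S \<subseteq> {q. g \<bullet> q > g \<bullet> p} \<union> F"
    using assms(2) S_in_\<Phi> by (force simp: F_def intro: hull_inc)
  ultimately have "\<Phi> \<subseteq> {q. g \<bullet> q > g \<bullet> p} \<union> F"
    unfolding \<Phi>_hull by (rule hull_minimal [rotated])
  with assms(1) show ?thesis
    by (auto simp: F_def)
qed

lemma coprime_scale:
  assumes "(a, b) \<noteq> (0, 0)"
  obtains a' b' k where "coprime a' b'" "k > 0" "\<And>q. lf a b q = k * lf a' b' q"
proof -
  have "gcd a b \<noteq> 0"
    using assms by simp
  then obtain a' b' where ab': "a = a' * gcd a b" "b = b' * gcd a b" "coprime a' b'"
    using gcd_coprime_exists by blast
  have "of_int a = of_int (gcd a b) * (of_int a' :: real)"
    "of_int b = of_int (gcd a b) * (of_int b' :: real)"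
    by (metis ab'(1) mult.commute of_int_mult) (metis ab'(2) mult.commute of_int_mult)
  then have "lf a b q = of_int (gcd a b) * lf a' b' q" for q
    unfolding lf_def by (simp add: algebra_simps)
  moreover have "0 < real_of_int (gcd a b)"
    using \<open>gcd a b \<noteq> 0\<close> by (simp add: order_less_le)
  ultimately show thesis
    using that ab'(3) by blast
qed

text \<open>
  If the supporting line meets \<open>S\<close> in two points then it already has rational slope; otherwise
  \<open>g \<bullet> (s - p)\<close> grows at least linearly on \<open>S\<close>, and a rational perturbation still supports.
\<close>
lemma rational_support:
  assumes p: "p \<in> \<Phi>" and g: "\<And>q. q \<in> \<Phi> \<Longrightarrow> g \<bullet> p \<le> g \<bullet> q" and w: "g \<bullet> w < 0"
  obtains a b where "coprime a b" "\<And>q. q \<in> \<Phi> \<Longrightarrow> lf a b p \<le> lf a b q" "lf a b w < 0"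
proof -
  define \<alpha> where "\<alpha> = g \<bullet> e1"
  define \<beta> where "\<beta> = g \<bullet> e2"
  have g_eq: "g \<bullet> q = \<alpha> * x q + \<beta> * y q" for q
    by (subst decomp [of q]) (simp add: inner_add_right \<alpha>_def \<beta>_def)
  have "\<exists>a b. (\<forall>q\<in>\<Phi>. lf a b p \<le> lf a b q) \<and> lf a b w < 0"
  proof (cases "\<exists>s\<in>S. \<exists>s'\<in>S. s \<noteq> s' \<and> g \<bullet> s = g \<bullet> p \<and> g \<bullet> s' = g \<bullet> p")
    case True
    then obtain s s' where s: "s \<in> S" "s' \<in> S" "s \<noteq> s'" "g \<bullet> s = g \<bullet> p" "g \<bullet> s' = g \<bullet> p"
      by blast
    have "s \<in> N" "s' \<in> N"
      using s S_subset by auto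
    then have "x (s - s') \<in> \<int>" "y (s - s') \<in> \<int>"
      by (simp_all add: mem_N)
    then obtain i j where ij: "x (s - s') = of_int i" "y (s - s') = of_int j"
      by (meson Ints_cases)
    have nz: "i \<noteq> 0 \<or> j \<noteq> 0"
    proof (rule ccontr)
      assume "\<not> ?thesis"
      then have "s - s' = 0"
        using decomp [of "s - s'"] ij by simp
      with s show False
        by simp
    qed
    have "g \<bullet> (s - s') = 0"
      using s by (simp add: inner_diff_right)
    then have ker: "\<alpha> * of_int i + \<beta> * of_int j = 0"
      using g_eq ij by metis
    \<comment> \<open>By \<open>ker\<close>, (\<alpha>, \<beta>) is a multiple of (-j, i); pairing
      with (-j, i) gives the factor.\<close>
    define k where "k = (\<beta> * of_int i - \<alpha> * of_int j) / (of_int i ^ 2 + of_int j ^ 2)"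
    have den: "(of_int i ^ 2 + of_int j ^ 2 :: real) \<noteq> 0"
      using nz by (simp add: sum_power2_eq_zero_iff)
    have "\<alpha> * (of_int i ^ 2 + of_int j ^ 2) = - (\<beta> * of_int i - \<alpha> * of_int j) * of_int j"
      using ker by algebra
    then have \<alpha>: "\<alpha> = - (k * of_int j)"
      using den by (simp add: k_def field_simps)
    have "\<beta> * (of_int i ^ 2 + of_int j ^ 2) = (\<beta> * of_int i - \<alpha> * of_int j) * of_int i"
      using ker by algebra
    then have \<beta>: "\<beta> = k * of_int i"
      using den by (simp add: k_def field_simps)
    have gk: "g \<bullet> q = k * lf (- j) i q" for q
      unfolding g_eq \<alpha> \<beta> lf_def by (simp add: algebra_simps)
    have "k \<noteq> 0"
      using w gk by auto
    then consider "k > 0" | "k < 0"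
      by linarith
    then show ?thesis
    proof cases
      case 1
      then have "(\<forall>q\<in>\<Phi>. lf (- j) i p \<le> lf (- j) i q) \<and> lf (- j) i w < 0"
        using g w by (auto simp: gk mult_less_0_iff)
      then show ?thesis
        by blast
    next
      case 2
      have "lf (- j) i q = - lf j (- i) q" for q
        by (simp add: lf_def)
      then have gk': "g \<bullet> q = (- k) * lf j (- i) q" for q
        using gk by simp
      have "(\<forall>q\<in>\<Phi>. lf j (- i) p \<le> lf j (- i) q) \<and> lf j (- i) w < 0"
        using g w 2 by (auto simp: gk' mult_less_0_iff zero_less_mult_iff)
      then show ?thesis
        by blast
    qed
  next
    case False
    have hull: "p \<in> convex hull (S \<inter> {q. g \<bullet> q = g \<bullet> p})"
      by (rule hull_Int_hyperplane) (use p g in auto)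
    then obtain s where s: "s \<in> S" "g \<bullet> s = g \<bullet> p"
      by (metis (mono_tags, lifting) IntE convex_hull_empty empty_iff ex_in_conv mem_Collect_eq)
    then have "S \<inter> {q. g \<bullet> q = g \<bullet> p} = {s}"
      using False by auto
    with hull have "p = s"
      by simp
    with s have pS: "p \<in> S"
      by simp
    have strict: "g \<bullet> p < g \<bullet> q" if "q \<in> \<Phi>" "q \<noteq> p" for q
    proof (rule ccontr)
      assume "\<not> ?thesis"
      then have eq: "g \<bullet> q = g \<bullet> p"
        using g [OF that(1)] by simp
      have "q \<in> convex hull (S \<inter> {r. g \<bullet> r = g \<bullet> q})"
        by (rule hull_Int_hyperplane) (use that g eq in auto)
      with eq \<open>S \<inter> {q. g \<bullet> q = g \<bullet> p} = {s}\<close> \<open>p = s\<close> that(2) show False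
        by simp
    qed
    \<comment> \<open>On this compact unit sphere \<open>g\<close> exceeds its value at
      \<open>p\<close> by some \<kappa> > 0. Other generators have distance at least 1 from
      \<open>p\<close>, so scaling \<open>s - p\<close> down to unit length stays in \<Phi> and
      gives linear growth on \<open>S\<close>.\<close>
    define D where "D = {q \<in> \<Phi>. norm1 (q - p) = 1}"
    have "closed D"
    proof -
      have "closed {q. norm1 (q - p) = 1}"
        by (intro closed_Collect_eq continuous_intros continuous_on_compose2 [OF continuous_norm1])
          auto
      moreover have "D = \<Phi> \<inter> {q. norm1 (q - p) = 1}"
        by (auto simp: D_def)
      ultimately show ?thesis
        using closed_\<Phi> by auto
    qed
    moreover have "bounded D"
      unfolding bounded_def
    proof (intro exI ballI)
      fix q assume "q \<in> D"
      then show "dist p q \<le> norm e1 + norm e2"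
        using norm_le_norm1 [of "q - p"] by (simp add: D_def dist_norm norm_minus_commute)
    qed
    ultimately have "compact D"
      by (simp add: compact_eq_bounded_closed)
    obtain \<kappa> where \<kappa>: "\<kappa> > 0" "\<And>q. q \<in> D \<Longrightarrow> \<kappa> \<le> g \<bullet> (q - p)"
    proof (cases "D = {}")
      case True
      then show ?thesis
        using that [of 1] by simp
    next
      case False
      have "continuous_on D (\<lambda>q. g \<bullet> (q - p))"
        by (intro continuous_intros)
      with \<open>compact D\<close> False obtain m where m: "m \<in> D" "\<And>q. q \<in> D \<Longrightarrow> g \<bullet> (m - p) \<le> g \<bullet> (q - p)"
        using continuous_attains_inf by meson
      have "m \<noteq> p"
        using m(1) by (auto simp: D_def norm1_def)
      with m(1) have "0 < g \<bullet> (m - p)"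
        using strict by (simp add: D_def inner_diff_right)
      then show ?thesis
        using that m(2) by blast
    qed
    have growth: "\<kappa> * norm1 (s - p) \<le> g \<bullet> (s - p)" if "s \<in> S" for s
    proof (cases "s = p")
      case False
      define k where "k = norm1 (s - p)"
      have k: "k \<ge> 1"
        unfolding k_def by (rule norm1_ge_1) (use that pS S_subset False in auto)
      define d where "d = (1 / k) *\<^sub>R (s - p)"
      have "p + d = (1 - 1 / k) *\<^sub>R p + (1 / k) *\<^sub>R s"
        by (simp add: d_def algebra_simps)
      also have "\<dots> \<in> \<Phi>"
        using k p S_in_\<Phi> [OF that] by (intro convexD_alt [OF convex_\<Phi>]) auto
      finally have "p + d \<in> \<Phi>" .
      moreover have "norm1 d = 1"
        using k unfolding d_def norm1_scaleR k_def [symmetric] by simp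
      ultimately have "p + d \<in> D"
        by (simp add: D_def)
      from \<kappa>(2) [OF this] have "\<kappa> \<le> (1 / k) * (g \<bullet> (s - p))"
        by (simp add: d_def)
      then show ?thesis
        using k by (simp add: k_def [symmetric] field_simps)
    qed (simp add: norm1_def)
    \<comment> \<open>Rounding the coefficients of n g costs at most \<open>norm1 v\<close> at
      \<open>v\<close>. The first summand makes n \<kappa> \<ge> 1, so growth absorbs this error on
      \<open>S\<close>; the second preserves the sign at \<open>w\<close>.\<close>
    obtain n :: nat where n: "real n > 1 / \<kappa> + norm1 w / (- (g \<bullet> w))"
      using reals_Archimedean2 by blast
    have nn: "norm1 w \<ge> 0"
      by (simp add: norm1_def)
    have "real n > 1 / \<kappa>" "real n > norm1 w / (- (g \<bullet> w))"
      using n \<kappa>(1) w nn by (smt (verit) divide_nonneg_pos divide_pos_pos)+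
    then have n1: "real n * \<kappa> \<ge> 1" and n2: "real n * (- (g \<bullet> w)) > norm1 w"
      using \<kappa>(1) w by (simp_all add: field_simps)
    define a where "a = \<lfloor>real n * \<alpha>\<rfloor>"
    define b where "b = \<lfloor>real n * \<beta>\<rfloor>"
    have approx: "\<bar>lf a b v - real n * (g \<bullet> v)\<bar> \<le> norm1 v" for v
    proof -
      have a: "\<bar>of_int a - real n * \<alpha>\<bar> \<le> 1" and b: "\<bar>of_int b - real n * \<beta>\<bar> \<le> 1"
        unfolding a_def b_def by linarith+
      have "lf a b v - real n * (g \<bullet> v) = (of_int a - real n * \<alpha>) * x v + (of_int b - real n * \<beta>) * y v"
        by (simp add: lf_def g_eq algebra_simps)
      also have "\<bar>\<dots>\<bar> \<le> \<bar>of_int a - real n * \<alpha>\<bar> * \<bar>x v\<bar> + \<bar>of_int b - real n * \<beta>\<bar> * \<bar>y v\<bar>"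
        by (metis abs_mult abs_triangle_ineq)
      also have "\<dots> \<le> 1 * \<bar>x v\<bar> + 1 * \<bar>y v\<bar>"
        using a b by (intro add_mono mult_right_mono) auto
      finally show ?thesis
        by (simp add: norm1_def)
    qed
    have "lf a b w < 0"
      using approx [of w] n2 by (simp add: abs_le_iff)
    moreover have "lf a b p \<le> lf a b s" if "s \<in> S" for s
    proof -
      have "norm1 (s - p) \<le> (real n * \<kappa>) * norm1 (s - p)"
        using mult_right_mono [OF n1, of "norm1 (s - p)"] by (simp add: norm1_def)
      also have "\<dots> \<le> real n * (g \<bullet> (s - p))"
        using mult_left_mono [OF growth [OF that], of "real n"] by (simp add: mult.assoc)
      finally have "0 \<le> lf a b (s - p)"
        using approx [of "s - p"] by linarith
      then show ?thesis
        by simp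
    qed
    ultimately show ?thesis
      using \<Phi>_lower_bound by blast
  qed
  then obtain a b where ab: "\<And>q. q \<in> \<Phi> \<Longrightarrow> lf a b p \<le> lf a b q" "lf a b w < 0"
    by blast
  then have "(a, b) \<noteq> (0, 0)"
    by (auto simp: lf_def)
  then obtain a' b' k where "coprime a' b'" "k > 0" "\<And>q. lf a b q = k * lf a' b' q"
    using coprime_scale by blast
  then show thesis
    using that [of a' b'] ab by (simp add: mult_less_0_iff)
qed

text \<open>A point outside \<Phi> is cut off by the supporting line at its closest point.
  Negativity on the direction towards the outside point survives the passage to rational
  slope.\<close>

lemma shrink_0: "shrink 0 = \<Phi>"
proof
  show "\<Phi> \<subseteq> shrink 0"
    by (auto simp: shrink_def valid_def)
  show "shrink 0 \<subseteq> \<Phi>"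
  proof (rule subsetI, rule ccontr)
    fix p assume p: "p \<in> shrink 0" "p \<notin> \<Phi>"
    define q where "q = closest_point \<Phi> p"
    have q: "q \<in> \<Phi>"
      using closed_\<Phi> \<Phi>_nonempty by (simp add: q_def closest_point_in_set)
    with p have "p \<noteq> q"
      by auto
    have "(q - p) \<bullet> q \<le> (q - p) \<bullet> r" if "r \<in> \<Phi>" for r
      using closest_point_dot [OF convex_\<Phi> closed_\<Phi> that, of p]
      by (simp add: q_def [symmetric] inner_diff_left inner_diff_right)
    moreover have "(q - p) \<bullet> (p - q) < 0"
      using \<open>p \<noteq> q\<close> inner_gt_zero_iff [of "q - p"] by (simp add: inner_diff_left inner_diff_right)
    ultimately obtain a b where ab: "coprime a b" "\<And>r. r \<in> \<Phi> \<Longrightarrow> lf a b q \<le> lf a b r"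
        "lf a b (p - q) < 0"
      using rational_support [OF q] by blast
    have "of_int \<lceil>lf a b q\<rceil> \<le> lf a b p"
      using shrinkD [OF p(1) ab(1) valid_ceiling [OF ab(2)]] by simp
    with ab(3) le_of_int_ceiling [of "lf a b q"] show False
      by simp
  qed
qed

section \<open>Lattice points in the interior of the propagation\<close>

lemma shrink_subset_\<Phi>: "shrink t \<subseteq> \<Phi>"
proof -
  have "shrink t \<subseteq> shrink 0"
  proof
    fix p assume p: "p \<in> shrink t"
    have "of_int c \<le> lf a b p" if "coprime a b" "valid a b c" for a b c
      using shrinkD [OF p that] by simp
    then show "p \<in> shrink 0"
      by (simp add: shrink_def)
  qed
  then show ?thesis
    by (simp add: shrink_0)
qed

text \<open>A boundary point would minimise some primitive functional over \<Phi>, and the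
  constraint of that functional, pushed by t > 0, excludes it.\<close>

lemma shrink_subset_interior:
  assumes "t > 0"
  shows "shrink t \<subseteq> interior \<Phi>"
proof (rule subsetI, rule ccontr)
  fix p assume p: "p \<in> shrink t" and ni: "p \<notin> interior \<Phi>"
  have p\<Phi>: "p \<in> \<Phi>"
    using p shrink_subset_\<Phi> by auto
  obtain g where g: "g \<noteq> 0" "\<And>q. q \<in> \<Phi> \<Longrightarrow> g \<bullet> p \<le> g \<bullet> q"
  proof (cases "interior \<Phi> = {}")
    case True
    then obtain g r where g: "g \<noteq> 0" "\<Phi> \<subseteq> {q. g \<bullet> q = r}"
      using empty_interior_subset_hyperplane [OF convex_\<Phi>] by metis
    then have "g \<bullet> q = r" if "q \<in> \<Phi>" for q
      using that by auto
    with p\<Phi> g(1) that [of g] show ?thesis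
      by simp
  next
    case False
    obtain g r where g: "g \<noteq> 0" "\<And>q. q \<in> {p} \<Longrightarrow> g \<bullet> q \<le> r" "\<And>q. q \<in> interior \<Phi> \<Longrightarrow> r \<le> g \<bullet> q"
      using separating_hyperplane_sets [of "{p}" "interior \<Phi>"] ni False convex_\<Phi>
      by (auto simp: convex_interior)
    have "closure (interior \<Phi>) = \<Phi>"
      using convex_closure_interior [OF convex_\<Phi> False] closed_\<Phi> by simp
    moreover have "closure (interior \<Phi>) \<subseteq> {q. r \<le> g \<bullet> q}"
      using g(3) by (intro closure_minimal closed_halfspace_ge) auto
    ultimately show ?thesis
      using that [of g] g by fastforce
  qed
  \<comment> \<open>Only a primitive functional minimal at \<open>p\<close> is wanted, so any
    direction on which \<open>g\<close> is negative will do.\<close>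
  have "g \<bullet> (- g) < 0"
    using g(1) by simp
  then obtain a b where ab: "coprime a b" "\<And>q. q \<in> \<Phi> \<Longrightarrow> lf a b p \<le> lf a b q"
    using rational_support [OF p\<Phi> g(2)] by blast
  have "of_int \<lceil>lf a b p\<rceil> + of_nat t \<le> lf a b p"
    using shrinkD [OF p ab(1) valid_ceiling [OF ab(2)]] by simp
  with assms le_of_int_ceiling [of "lf a b p"] show False
    by linarith
qed

text \<open>
  Near an interior point of \<open>\<Phi>\<close> all but finitely many functionals satisfy their constraint with
  any prescribed slack.
\<close>
lemma locally_finite_constraints:
  assumes "p \<in> interior \<Phi>"
  obtains A where "finite A"
    "\<forall>\<^sub>F q in nhds p. \<forall>a b c. (a, b) \<notin> A \<longrightarrow> valid a b c \<longrightarrow> of_int c + r \<le> lf a b q"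
proof -
  obtain \<epsilon> where \<epsilon>: "\<epsilon> > 0" "ball p \<epsilon> \<subseteq> \<Phi>"
    using assms by (meson mem_interior)
  define m where "m = norm e1 + norm e2"
  \<comment> \<open>Chosen so that moves by \<delta> along \<open>e1\<close> or \<open>e2\<close>
    have norm at most \<epsilon> / 2. Testing a valid inequality after such moves from
    \<open>q\<close>, in both directions, gives slack \<delta> max(|a|, |b|) at \<open>q\<close>,
    which is at least \<open>r\<close> outside \<open>A\<close>.\<close>
  define \<delta> where "\<delta> = \<epsilon> / 2 / m"
  have "m > 0"
    unfolding m_def using coord_e(1) by (smt (verit) linear_0 linear_x norm_ge_zero zero_less_norm_iff)
  then have \<delta>: "\<delta> > 0" "\<delta> * m = \<epsilon> / 2"
    using \<epsilon>(1) by (simp_all add: \<delta>_def)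
  define A where "A = {- \<lceil>r / \<delta>\<rceil>..\<lceil>r / \<delta>\<rceil>} \<times> {- \<lceil>r / \<delta>\<rceil>..\<lceil>r / \<delta>\<rceil>}"
  have main: "of_int c + r \<le> lf a b q"
    if q: "dist q p < \<epsilon> / 2" and ab: "(a, b) \<notin> A" and v: "valid a b c" for q a b c
  proof -
    have in\<Phi>: "q + d \<in> \<Phi>" if "norm d \<le> \<epsilon> / 2" for d
    proof -
      have "dist p (q + d) \<le> dist q p + norm d"
        using dist_triangle [of p "q + d" q] by (simp add: dist_commute) (simp add: dist_norm)
      then show ?thesis
        using q that \<epsilon>(2) by (auto simp: subset_iff)
    qed
    have "\<delta> * norm e1 \<le> \<delta> * m" "\<delta> * norm e2 \<le> \<delta> * m"
      using \<delta>(1) by (simp_all add: m_def)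
    then have n: "norm (\<delta> *\<^sub>R e1) \<le> \<epsilon> / 2" "norm (\<delta> *\<^sub>R e2) \<le> \<epsilon> / 2"
      using \<delta> by simp_all
    have E: "of_int c \<le> lf a b q + \<delta> * of_int a" "of_int c \<le> lf a b q - \<delta> * of_int a"
      "of_int c \<le> lf a b q + \<delta> * of_int b" "of_int c \<le> lf a b q - \<delta> * of_int b"
      using v in\<Phi> [of "\<delta> *\<^sub>R e1"] in\<Phi> [of "- (\<delta> *\<^sub>R e1)"] in\<Phi> [of "\<delta> *\<^sub>R e2"] in\<Phi> [of "- (\<delta> *\<^sub>R e2)"] n
      by (fastforce simp: valid_def lf_def algebra_simps)+
    have big: "r \<le> \<delta> * \<bar>of_int k\<bar>" if "k \<notin> {- \<lceil>r / \<delta>\<rceil>..\<lceil>r / \<delta>\<rceil>}" for k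
    proof -
      have "\<bar>k\<bar> > \<lceil>r / \<delta>\<rceil>"
        using that by auto
      then have "r / \<delta> \<le> of_int \<bar>k\<bar>"
        by linarith
      then show ?thesis
        using \<delta>(1) by (simp add: field_simps)
    qed
    from ab have "r \<le> \<delta> * \<bar>of_int a\<bar> \<or> r \<le> \<delta> * \<bar>of_int b\<bar>"
      using big by (auto simp: A_def)
    with E show ?thesis
      by (auto simp: abs_if split: if_splits)
  qed
  have "finite A"
    by (simp add: A_def)
  moreover have "\<forall>\<^sub>F q in nhds p. \<forall>a b c. (a, b) \<notin> A \<longrightarrow> valid a b c \<longrightarrow> of_int c + r \<le> lf a b q"
    unfolding eventually_nhds_metric using main \<epsilon>(1) by (intro exI [of _ "\<epsilon> / 2"]) auto
  ultimately show thesis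
    by (rule that)
qed

text \<open>A strict inequality between integers gains 1, which takes interior lattice points to
  time t + 1. Conversely, slack 1 in finitely many constraints survives a small move by continuity,
  and local finiteness handles the rest.\<close>

lemma lattice_Int_interior_shrink: "N \<inter> interior (shrink t) = N \<inter> shrink (Suc t)"
proof (intro equalityI subsetI IntI; elim IntE)
  fix p assume "p \<in> N" and p: "p \<in> interior (shrink t)"
  show "p \<in> shrink (Suc t)"
    unfolding shrink_def
  proof (intro CollectI allI impI)
    fix a b c assume ab: "coprime a b" and v: "valid a b c"
    obtain g where g: "g \<noteq> 0" "lf a b = (\<lambda>p. g \<bullet> p)"
      using lf_inner [OF ab] by blast
    have "shrink t \<subseteq> {p. g \<bullet> p \<ge> of_int c + of_nat t}"
      using shrinkD [OF _ ab v] g by auto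
    then have "p \<in> interior {p. g \<bullet> p \<ge> of_int c + of_nat t}"
      using p interior_mono by blast
    then have less: "of_int c + of_nat t < lf a b p"
      using g by simp
    obtain k where "lf a b p = of_int k"
      using lf_of_int [OF \<open>p \<in> N\<close>] by blast
    moreover from this less have "real_of_int (c + int t) < of_int k"
      by simp
    then have "c + int (Suc t) \<le> k"
      by (simp only: of_int_less_iff)
    then have "real_of_int (c + int (Suc t)) \<le> of_int k"
      by (simp only: of_int_le_iff)
    ultimately show "of_int c + of_nat (Suc t) \<le> lf a b p"
      by simp
  qed
next
  fix p assume p: "p \<in> shrink (Suc t)"
  then have "p \<in> interior \<Phi>"
    using shrink_subset_interior [of "Suc t"] by auto
  then obtain A where A: "finite A"
    "\<forall>\<^sub>F q in nhds p. \<forall>a b c. (a, b) \<notin> A \<longrightarrow> valid a b c \<longrightarrow> of_int c + of_nat t \<le> lf a b q"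
    by (rule locally_finite_constraints)
  have "\<forall>\<^sub>F q in nhds p. lf a b p - 1 < lf a b q" for a b
    using open_lf_greater by (rule eventually_nhds_in_open [THEN eventually_mono]) auto
  then have "\<forall>\<^sub>F q in nhds p. \<forall>(a, b)\<in>A. lf a b p - 1 < lf a b q"
    using A(1) by (auto intro!: eventually_ball_finite)
  with A(2) have "\<forall>\<^sub>F q in nhds p. q \<in> shrink t"
  proof eventually_elim
    case (elim q)
    show ?case
      unfolding shrink_def
    proof (intro CollectI allI impI)
      fix a b c assume ab: "coprime a b" and v: "valid a b c"
      show "of_int c + of_nat t \<le> lf a b q"
      proof (cases "(a, b) \<in> A")
        case True
        with elim(2) have "lf a b p - 1 < lf a b q"
          by auto
        with shrinkD [OF p ab v] show ?thesis
          by simp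
      qed (use elim(1) v in blast)
    qed
  qed
  then show "p \<in> interior (shrink t)"
    unfolding eventually_nhds by (auto intro: interiorI)
qed auto

section \<open>Tight functionals and the hull of the lattice points\<close>

definition tight :: "nat \<Rightarrow> 'a \<Rightarrow> int \<Rightarrow> int \<Rightarrow> bool" where
  "tight t p a b \<longleftrightarrow> coprime a b \<and> (\<exists>c. valid a b c \<and> lf a b p = of_int c + of_nat t)"

lemma shrink_eq_INT:
  "shrink t =
    (\<Inter>(a, b, c) \<in> {(a, b, c). coprime a b \<and> valid a b c}. {p. of_int c + of_nat t \<le> lf a b p})"
  by (auto simp: shrink_def)

lemma closed_shrink: "closed (shrink t)"
  unfolding shrink_eq_INT
  by (auto intro!: closed_INT closed_Collect_le continuous_intros continuous_lf)

lemma convex_shrink: "convex (shrink t)"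
  unfolding shrink_eq_INT by (auto intro!: convex_INT convex_lf_ge)

text \<open>At the last point of the segment inside \<open>shrink t\<close> some tight functional
  decreases along \<open>v\<close>. Otherwise the tight constraints would persist beyond it, and so
  would all others for a short while, by local finiteness.\<close>

lemma exit_point:
  assumes t: "t > 0" and q: "q \<in> shrink t" and s: "0 \<le> s" and out: "q + s *\<^sub>R v \<notin> shrink t"
  obtains r a b where "0 \<le> r" "q + r *\<^sub>R v \<in> shrink t" "tight t (q + r *\<^sub>R v) a b" "lf a b v < 0"
proof -
  define R where "R = {r \<in> {0..s}. q + r *\<^sub>R v \<in> shrink t}"
  have "closed {r. q + r *\<^sub>R v \<in> shrink t}"
    using closed_vimage [OF closed_shrink, of "\<lambda>r. q + r *\<^sub>R v" t] by (simp add: vimage_def continuous_intros)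
  moreover have "R = {0..s} \<inter> {r. q + r *\<^sub>R v \<in> shrink t}"
    by (auto simp: R_def)
  ultimately have "compact R"
    by (simp add: compact_Int_closed)
  moreover have "0 \<in> R"
    using q s by (simp add: R_def)
  ultimately obtain r where r: "r \<in> R" "\<And>r'. r' \<in> R \<Longrightarrow> r' \<le> r"
    using compact_attains_sup by (metis empty_iff)
  define z where "z = q + r *\<^sub>R v"
  have z: "z \<in> shrink t" and r0: "0 \<le> r"
    using r by (auto simp: R_def z_def)
  have "r < s"
    using r out by (force simp: R_def order_less_le)
  have "\<exists>a b. tight t z a b \<and> lf a b v < 0"
  proof (rule ccontr)
    assume no: "\<not> ?thesis"
    have "z \<in> interior \<Phi>"
      using z shrink_subset_interior t by auto
    then obtain A where A: "finite A"
      "\<forall>\<^sub>F q in nhds z. \<forall>a b c. (a, b) \<notin> A \<longrightarrow> valid a b c \<longrightarrow> of_int c + of_nat t \<le> lf a b q"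
      by (rule locally_finite_constraints)
    \<comment> \<open>This threshold is the largest integer strictly below the value at
      \<open>z\<close>. The integral bound of a constraint that is not tight cannot exceed it, so it
      serves all valid \<open>c\<close> at once.\<close>
    have "\<forall>\<^sub>F q in nhds z. of_int (\<lceil>lf a b z\<rceil> - 1) < lf a b q" for a b
      using open_lf_greater
      by (rule eventually_nhds_in_open [THEN eventually_mono]) (auto, linarith)
    then have "\<forall>\<^sub>F q in nhds z. \<forall>(a, b)\<in>A. of_int (\<lceil>lf a b z\<rceil> - 1) < lf a b q"
      using A(1) by (auto intro!: eventually_ball_finite)
    with A(2) have ev: "\<forall>\<^sub>F q in nhds z. \<forall>a b c. coprime a b \<longrightarrow> valid a b c \<longrightarrow>
        \<not> tight t z a b \<longrightarrow> of_int c + of_nat t \<le> lf a b q"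
    proof eventually_elim
      case (elim q)
      show ?case
      proof (intro allI impI)
        fix a b c assume ab: "coprime a b" and v: "valid a b c" and nt: "\<not> tight t z a b"
        show "of_int c + of_nat t \<le> lf a b q"
        proof (cases "(a, b) \<in> A")
          case True
          have "of_int c + of_nat t < lf a b z"
            using shrinkD [OF z ab v] nt ab v by (fastforce simp: tight_def)
          then have "c + int t \<le> \<lceil>lf a b z\<rceil> - 1"
            by linarith
          then have "real_of_int (c + int t) \<le> of_int (\<lceil>lf a b z\<rceil> - 1)"
            by (simp only: of_int_le_iff)
          moreover have "of_int (\<lceil>lf a b z\<rceil> - 1) < lf a b q"
            using elim(2) True by blast
          ultimately show ?thesis
            by simp
        qed (use elim(1) v in blast)
      qed
    qed
    have "((\<lambda>r'. q + r' *\<^sub>R v) \<longlongrightarrow> z) (at_right r)"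
      unfolding z_def by (intro tendsto_intros)
    then have "\<forall>\<^sub>F r' in at_right r. \<forall>a b c. coprime a b \<longrightarrow> valid a b c \<longrightarrow>
        \<not> tight t z a b \<longrightarrow> of_int c + of_nat t \<le> lf a b (q + r' *\<^sub>R v)"
      using ev by (rule filterlim_iff [THEN iffD1, rule_format])
    moreover have "\<forall>\<^sub>F r' in at_right r. r < r' \<and> r' < s"
      using eventually_at_right_real [OF \<open>r < s\<close>] by (auto elim: eventually_mono)
    ultimately have "\<forall>\<^sub>F r' in at_right r. r < r' \<and> r' < s \<and> q + r' *\<^sub>R v \<in> shrink t"
    proof eventually_elim
      case (elim r')
      have "of_int c + of_nat t \<le> lf a b (q + r' *\<^sub>R v)" if ab: "coprime a b" and v: "valid a b c" for a b c
      proof (cases "tight t z a b")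
        case True
        with no have "0 \<le> lf a b v"
          by (meson not_le)
        then have "lf a b z \<le> lf a b (q + r' *\<^sub>R v)"
          using elim(2) by (simp add: z_def mult_right_mono)
        with shrinkD [OF z ab v] show ?thesis
          by simp
      qed (use elim(1) that in blast)
      with elim(2) show ?case
        by (auto simp: shrink_def)
    qed
    then obtain r' where "r < r'" "r' < s" "q + r' *\<^sub>R v \<in> shrink t"
      using eventually_happens trivial_limit_at_right_real by blast
    with r0 r(2) [of r'] show False
      by (simp add: R_def)
  qed
  with that r0 z show thesis
    by (auto simp: z_def)
qed

text \<open>
  Completing one tight functional to a basis inside the triangle spanned by two of them gives, by
  concavity of the support function, another tight functional; the values of a basis of tight
  functionals are integers.
\<close>
lemma two_tight_imp_lattice:
  assumes p: "p \<in> shrink t" and T1: "tight t p a b" and T2: "tight t p c d" and det: "a * d - b * c \<noteq> 0"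
  shows "p \<in> N"
proof -
  have main: "p \<in> N" if T1: "tight t p a b" and T2: "tight t p c d" and n: "n = a * d - b * c" "n > 0"
    for a b c d n
  proof -
    obtain k1 where ab: "coprime a b" and k1: "valid a b k1" "lf a b p = of_int k1 + of_nat t"
      using T1 by (auto simp: tight_def)
    obtain k2 where k2: "valid c d k2" "lf c d p = of_int k2 + of_nat t"
      using T2 by (auto simp: tight_def)
    obtain e f i where ef: "n * e = i * a + c" "n * f = i * b + d" and i: "0 \<le> i" "i < n"
      and det: "a * f - b * e = 1"
      using basis_completion_in_triangle [OF ab n] by metis
    have ef': "of_int n * of_int e = of_int i * of_int a + (of_int c :: real)"
      "of_int n * of_int f = of_int i * of_int b + (of_int d :: real)"
      using ef by (metis of_int_add of_int_mult)+
    have comb: "of_int n * lf e f q = of_int i * lf a b q + lf c d q" for q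
    proof -
      have "of_int n * lf e f q = (of_int n * of_int e) * x q + (of_int n * of_int f) * y q"
        by (simp add: lf_def algebra_simps)
      then show ?thesis
        unfolding ef' by (simp add: lf_def algebra_simps)
    qed
    \<comment> \<open>The lower bound for \<open>lf e f\<close> on \<Phi> that \<open>comb\<close>
      yields from \<open>k1\<close> and \<open>k2\<close>.\<close>
    define \<rho> where "\<rho> = (of_int i * of_int k1 + of_int k2) / (of_int n :: real)"
    have np: "(0::real) < of_int n"
      using n(2) by simp
    then have \<rho>: "of_int n * \<rho> = of_int i * of_int k1 + of_int k2"
      by (simp add: \<rho>_def)
    have "\<rho> \<le> lf e f q" if "q \<in> \<Phi>" for q
    proof -
      have "of_int i * of_int k1 + of_int k2 \<le> of_int n * lf e f q"
        unfolding comb using k1 k2 i that by (intro add_mono mult_left_mono) (auto simp: valid_def)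
      then show ?thesis
        using np by (simp add: \<rho>_def field_simps)
    qed
    then have v: "valid e f \<lceil>\<rho>\<rceil>"
      by (rule valid_ceiling)
    have "coprime e f"
      using det by (intro coprimeI) (metis dvd_diff dvd_mult)
    from shrinkD [OF p this v] have lower: "of_int \<lceil>\<rho>\<rceil> + of_nat t \<le> lf e f p" .
    \<comment> \<open>The triangle enters as i + 1 \<le> n: it bounds \<open>lf e f p\<close> above
      by \<rho> + t, while the rounded bound gives the ceiling of \<rho> plus t from below. Hence
      the value is an integer.\<close>
    have "(of_int i + 1) * of_nat t \<le> of_int n * (of_nat t :: real)"
      using i by (intro mult_right_mono) (simp_all flip: of_int_le_iff)
    then have "of_int n * lf e f p \<le> of_int n * (\<rho> + of_nat t)"
      using \<rho> unfolding comb k1 k2 by (simp add: algebra_simps)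
    then have "lf e f p \<le> \<rho> + of_nat t"
      using np by simp
    with lower have "lf e f p = of_int (\<lceil>\<rho>\<rceil> + int t)"
      using le_of_int_ceiling [of \<rho>] unfolding of_int_add of_int_of_nat_eq by linarith
    then have B: "lf e f p \<in> \<int>"
      by simp
    have A: "lf a b p \<in> \<int>"
      using k1 by simp
    have det': "of_int a * of_int f - of_int b * of_int e = (1::real)"
      using det by (metis of_int_1 of_int_diff of_int_mult)
    \<comment> \<open>Cramer's rule with determinant 1 recovers the coordinates with integer
      coefficients.\<close>
    have "x p = of_int f * lf a b p - of_int b * lf e f p" "y p = of_int a * lf e f p - of_int e * lf a b p"
      unfolding lf_def using det' by algebra+
    then show ?thesis
      using A B by (simp add: mem_N)
  qed
  show ?thesis
  proof (cases "a * d - b * c > 0")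
    case True
    then show ?thesis
      using main [OF T1 T2] by simp
  next
    case False
    then have "c * b - d * a > 0"
      using det by (simp add: mult.commute)
    then show ?thesis
      using main [OF T2 T1] by simp
  qed
qed

abbreviation lhull :: "nat \<Rightarrow> 'a set" where
  "lhull t \<equiv> convex hull (N \<inter> shrink t)"

lemma between_in_lhull:
  assumes "p + r *\<^sub>R v \<in> lhull t" "p + s *\<^sub>R (- v) \<in> lhull t" "0 \<le> r" "0 \<le> s"
  shows "p \<in> lhull t"
proof (cases "r + s = 0")
  case True
  then have "r = 0"
    using assms(3,4) by linarith
  then show ?thesis
    using assms(1) by simp
next
  case False
  define u where "u = r / (r + s)"
  have u: "0 \<le> u" "u \<le> 1" and us: "(1 - u) * r = u * s"
    using assms(3,4) False by (simp_all add: u_def field_simps)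
  have "(1 - u) *\<^sub>R (p + r *\<^sub>R v) + u *\<^sub>R (p + s *\<^sub>R (- v)) \<in> lhull t"
    using assms u by (intro convexD_alt) auto
  also have "(1 - u) *\<^sub>R (p + r *\<^sub>R v) + u *\<^sub>R (p + s *\<^sub>R (- v)) = p + ((1 - u) * r - u * s) *\<^sub>R v"
    by (simp add: algebra_simps)
  finally show ?thesis
    using us by simp
qed

text \<open>The line on which the tight functional is constant has a lattice point in either
  direction. If that point lies outside \<open>shrink t\<close>, the ray leaves earlier through a
  second tight functional, not constant on the line and hence independent of the first, so the exit
  point is a lattice point.\<close>

lemma tight_in_lhull:
  assumes t: "t > 0" and p: "p \<in> shrink t" and T: "tight t p a b"
  shows "p \<in> lhull t"
proof -
  define v where "v = of_int a *\<^sub>R e2 - of_int b *\<^sub>R e1"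
  obtain c where ab: "coprime a b" and c: "valid a b c" "lf a b p = of_int c + of_nat t"
    using T by (auto simp: tight_def)
  have lfv: "lf a b v = 0"
    by (simp add: v_def lf_def)
  have reach: "\<exists>r\<ge>0. p + r *\<^sub>R w \<in> lhull t"
    if w: "w = v \<or> w = - v" and s: "0 \<le> s" "p + s *\<^sub>R w \<in> N" for w s
  proof (cases "p + s *\<^sub>R w \<in> shrink t")
    case True
    with s show ?thesis
      by (auto intro: hull_inc)
  next
    case False
    then obtain r a' b' where r: "0 \<le> r" "p + r *\<^sub>R w \<in> shrink t" "tight t (p + r *\<^sub>R w) a' b'"
      "lf a' b' w < 0"
      using exit_point [OF t p s(1)] by blast
    have "lf a b (p + r *\<^sub>R w) = of_int c + of_nat t"
      using w lfv c(2) by auto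
    then have T': "tight t (p + r *\<^sub>R w) a b"
      using ab c(1) by (auto simp: tight_def)
    have "lf a' b' v = of_int (a * b' - b * a')"
      by (simp add: v_def lf_def)
    moreover have "lf a' b' v \<noteq> 0"
      using r(4) w by auto
    ultimately have "a * b' - b * a' \<noteq> 0"
      by (metis of_int_0)
    with two_tight_imp_lattice [OF r(2) T' r(3)] r(1,2) show ?thesis
      by (auto intro: hull_inc)
  qed
  obtain s where s: "0 \<le> s" "p + s *\<^sub>R v \<in> N"
    using lattice_point_on_ray [OF ab, of p] c(2) by (auto simp: v_def)
  \<comment> \<open>Negating (a, b) reverses \<open>v\<close>, which gives the lattice point in the
    opposite direction.\<close>
  have "lf (- a) (- b) p = - lf a b p"
    by (simp add: lf_def)
  then have "lf (- a) (- b) p \<in> \<int>"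
    using c(2) by simp
  moreover have "coprime (- a) (- b)"
    using ab by simp
  ultimately obtain s' where s': "0 \<le> s'" "p + s' *\<^sub>R (- v) \<in> N"
    using lattice_point_on_ray [of "- a" "- b" p] by (auto simp: v_def)
  show ?thesis
    using reach [OF _ s] reach [OF _ s'] between_in_lhull by blast
qed

text \<open>If the target is outside \<open>shrink t\<close>, the ray leaves at a point with a tight
  functional, already known to lie in the hull.\<close>

lemma ray_meets_lhull:
  assumes "t > 0" "p \<in> shrink t" "0 \<le> s" "p + s *\<^sub>R v \<in> shrink t \<Longrightarrow> p + s *\<^sub>R v \<in> lhull t"
  obtains r where "0 \<le> r" "p + r *\<^sub>R v \<in> lhull t"
proof (cases "p + s *\<^sub>R v \<in> shrink t")
  case True
  then show ?thesis
    using assms that by blast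
next
  case False
  then show ?thesis
    using exit_point [OF assms(1-3)] tight_in_lhull [OF assms(1)] that by metis
qed

lemma shrink_eq_lhull:
  assumes t: "t > 0"
  shows "lhull t = shrink t"
proof
  show "lhull t \<subseteq> shrink t"
    by (simp add: hull_minimal convex_shrink)
  have integral: "p \<in> lhull t" if p: "p \<in> shrink t" and xp: "x p \<in> \<int>" for p
  proof -
    \<comment> \<open>As \<open>x p\<close> is integral, rounding \<open>y p\<close> up or down
      makes the target a lattice point.\<close>
    obtain r where "0 \<le> r" "p + r *\<^sub>R e2 \<in> lhull t"
      by (rule ray_meets_lhull [OF t p, of "of_int \<lceil>y p\<rceil> - y p" e2])
        (use xp in \<open>auto intro!: hull_inc simp: mem_N\<close>)
    moreover obtain s where "0 \<le> s" "p + s *\<^sub>R (- e2) \<in> lhull t"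
      by (rule ray_meets_lhull [OF t p, of "y p - of_int \<lfloor>y p\<rfloor>" "- e2"])
        (use xp in \<open>auto intro!: hull_inc simp: mem_N\<close>)
    ultimately show ?thesis
      using between_in_lhull by blast
  qed
  show "shrink t \<subseteq> lhull t"
  proof
    fix p assume p: "p \<in> shrink t"
    obtain r where "0 \<le> r" "p + r *\<^sub>R e1 \<in> lhull t"
      by (rule ray_meets_lhull [OF t p, of "of_int \<lceil>x p\<rceil> - x p" e1])
        (auto intro!: integral)
    moreover obtain s where "0 \<le> s" "p + s *\<^sub>R (- e1) \<in> lhull t"
      by (rule ray_meets_lhull [OF t p, of "x p - of_int \<lfloor>x p\<rfloor>" "- e1"])
        (auto intro!: integral)
    ultimately show "p \<in> lhull t"
      using between_in_lhull by blast
  qed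
qed

section \<open>Induction on time and choice of coordinates\<close>

lemma lattice_evolution_eq: "lattice_evolution N \<Phi> t = shrink t"
proof (induction t)
  case 0
  then show ?case
    by (simp add: shrink_0)
next
  case (Suc t)
  then show ?case
    using shrink_eq_lhull [of "Suc t"] by (simp add: lattice_Int_interior_shrink)
qed

end

lemma rank_two_lattice_coordinates:
  assumes "rank_two_lattice N"
  obtains e1 e2 x y where "lattice_coordinates e1 e2 x y N"
proof -
  obtain e1 e2 where ne: "e1 \<noteq> e2" and ind: "independent {e1, e2}" and sp: "span {e1, e2} = UNIV"
    and N: "N = {of_int m *\<^sub>R e1 + of_int n *\<^sub>R e2 | m n :: int. True}"
    using assms unfolding rank_two_lattice_def by blast
  define x where "x = (\<lambda>p. representation {e1, e2} p e1)"
  define y where "y = (\<lambda>p. representation {e1, e2} p e2)"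
  have lin: "linear x" "linear y"
    unfolding x_def y_def using ind sp
    by (auto intro!: linearI simp: real_vector.representation_add real_vector.representation_scale)
  have decomp: "p = x p *\<^sub>R e1 + y p *\<^sub>R e2" for p
    using real_vector.sum_representation_eq [OF ind, of p "{e1, e2}"] sp ne by (simp add: x_def y_def)
  have co: "x e1 = 1" "x e2 = 0" "y e1 = 0" "y e2 = 1"
    using ind ne by (simp_all add: x_def y_def real_vector.representation_basis)
  have "p \<in> N \<longleftrightarrow> x p \<in> \<int> \<and> y p \<in> \<int>" for p
  proof
    assume "p \<in> N"
    then obtain m n where "p = of_int m *\<^sub>R e1 + of_int n *\<^sub>R e2"
      unfolding N by blast
    then show "x p \<in> \<int> \<and> y p \<in> \<int>"
      using lin co by (simp add: linear_add linear_cmul)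
  next
    assume "x p \<in> \<int> \<and> y p \<in> \<int>"
    then obtain m n where "x p = of_int m" "y p = of_int n"
      by (meson Ints_cases)
    with decomp [of p] show "p \<in> N"
      unfolding N by auto
  qed
  then have "lattice_coordinates e1 e2 x y N"
    using lin decomp co by (intro lattice_coordinates.intro)
  then show thesis
    by (rule that)
qed

theorem proposition28:
  fixes N \<Phi> :: "'a::euclidean_space set" and t :: nat
  assumes "rank_two_lattice N"
    and "lattice_polygonal_domain N \<Phi>"
  shows "lattice_evolution N \<Phi> t = tropical_propagation N \<Phi> (real t)"
proof -
  obtain e1 e2 x y where "lattice_coordinates e1 e2 x y N"
    using rank_two_lattice_coordinates [OF assms(1)] by blast
  then interpret lattice_coordinates e1 e2 x y N .
  obtain S where "S \<subseteq> N" "\<Phi> = convex hull S" "closed \<Phi>" "\<Phi> \<noteq> {}"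
    using assms(2) unfolding lattice_polygonal_domain_def by blast
  then interpret lattice_hull e1 e2 x y N S \<Phi>
    by unfold_locales
  show ?thesis
    by (simp add: lattice_evolution_eq tropical_propagation_eq)
qed

end
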